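(* Let $m,d$ be integers with $d\geq 1$ and let $f: S^m\rightarrow \mathbb{R}^d$ be a continuous map. If $m>d$, then there exists a pair of mutually orthogonal points $p_1,p_2\in S^m$ such that $f(p_1)=f(p_2)$.
   Context: $S^m$ denotes the unit sphere in $\mathbb{R}^{m+1}$. Points of $S^m$ are mutually orthogonal if they are pairwise orthogonal as unit vectors of $\mathbb{R}^{m+1}$ with the standard inner product. *)

theory Defs
  imports "HOL-Analysis.Analysis"
begin

end

theory Submission
  imports Defs "HOL-Homology.Homology"
begin

text \<open>
  Fix a unit vector \<open>u\<close> and let \<open>v\<close> range over the unit sphere of the hyperplane \<open>W\<close>
  orthogonal to \<open>u\<close>. The points \<open>(u + v) / sqrt 2\<close> and \<open>(u - v) / sqrt 2\<close> are orthogonal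
  unit vectors, and replacing \<open>v\<close> by \<open>- v\<close> exchanges them. Hence the difference of the
  values of \<open>f\<close> at these points is an odd function of \<open>v\<close> on a sphere of dimension
  \<open>m - 1 \<ge> d\<close> with values in a \<open>d\<close>-dimensional space. By the Borsuk--Ulam theorem it has a zero.

  The Borsuk--Ulam theorem (\<open>Borsuk_Ulam_subspace\<close>) is derived from Borsuk's theorem that
  odd self-maps of spheres have odd degree (\<open>odd_map_imp_odd_sphere_degree\<close>): an odd map
  from a sphere to its equator would restrict to an odd self-map of the equator that is
  nullhomotopic, hence of degree zero. Borsuk's theorem goes by induction on the dimension.
  Homology compares the parities of the degrees of an odd map and of its restriction to the
  equator, provided that the map preserves the equator (\<open>sphere_degree_equator_parity\<close>). An
  arbitrary odd map is brought into this form by approximating it by an odd polynomial map,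
  which for reasons of dimension misses a line on the equator
  (\<open>sgn_differentiable_image_misses_direction\<close>), and pushing the image of the equator away
  from that line.
\<close>

section \<open>Coordinate spheres\<close>

text \<open>
  The degree \<open>Brouwer_degree2\<close> concerns the spheres \<open>nsphere n\<close> of real sequences, one for each
  \<open>n\<close>, whereas polynomial approximation and the negligibility of smooth images concern
  Euclidean types, where the type fixes the dimension. Numbering the standard basis gives
  inside one type a nested family of coordinate spheres, so that an induction on the
  dimension of the sphere can take place there.
\<close>

definition axis_vec :: "nat \<Rightarrow> 'a::euclidean_space" where
  "axis_vec = (SOME b. bij_betw b {..<DIM('a)} Basis)"

lemma bij_betw_axis_vec: "bij_betw (axis_vec :: nat \<Rightarrow> 'a::euclidean_space) {..<DIM('a)} Basis"
proof -
  have "\<exists>b. bij_betw b {..<DIM('a)} (Basis :: 'a set)"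
    using ex_bij_betw_nat_finite[OF finite_Basis] by (auto simp: atLeast0LessThan)
  then show ?thesis
    unfolding axis_vec_def by (rule someI_ex)
qed

lemma axis_vec_in_Basis: "i < DIM('a) \<Longrightarrow> (axis_vec i :: 'a::euclidean_space) \<in> Basis"
  using bij_betw_axis_vec bij_betwE by blast

lemma inner_axis_vec:
  assumes "i < DIM('a)" "j < DIM('a)"
  shows "(axis_vec i :: 'a::euclidean_space) \<bullet> axis_vec j = (if i = j then 1 else 0)"
proof -
  have "axis_vec i = (axis_vec j :: 'a) \<longleftrightarrow> i = j"
    using bij_betw_axis_vec[where 'a='a] assms by (auto simp: bij_betw_def inj_on_def)
  then show ?thesis
    using assms by (simp add: inner_Basis axis_vec_in_Basis)
qed

lemma norm_axis_vec: "i < DIM('a) \<Longrightarrow> norm (axis_vec i :: 'a::euclidean_space) = 1"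
  by (simp add: axis_vec_in_Basis)

lemma sum_axis_vec: "(\<Sum>i<DIM('a). (y \<bullet> axis_vec i) *\<^sub>R axis_vec i) = (y :: 'a::euclidean_space)"
proof -
  have "(\<Sum>i<DIM('a). (y \<bullet> axis_vec i) *\<^sub>R axis_vec i) = (\<Sum>b\<in>Basis. (y \<bullet> b) *\<^sub>R b)"
    by (rule sum.reindex_bij_betw[OF bij_betw_axis_vec, of "\<lambda>b. (y \<bullet> b) *\<^sub>R b"])
  then show ?thesis by (simp add: euclidean_representation)
qed

definition coord_subspace :: "nat \<Rightarrow> 'a::euclidean_space set" where
  "coord_subspace n = span (axis_vec ` {..n})"

definition coord_sphere :: "nat \<Rightarrow> 'a::euclidean_space set" where
  "coord_sphere n = sphere 0 1 \<inter> coord_subspace n"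

lemma subspace_coord_subspace: "subspace (coord_subspace n)"
  by (simp add: coord_subspace_def)

lemma axis_vec_in_coord_subspace: "i \<le> n \<Longrightarrow> axis_vec i \<in> coord_subspace n"
  by (simp add: coord_subspace_def span_base)

lemma mem_coord_subspace_iff:
  fixes y :: "'a::euclidean_space"
  assumes "n < DIM('a)"
  shows "y \<in> coord_subspace n \<longleftrightarrow> (\<forall>i. n < i \<longrightarrow> i < DIM('a) \<longrightarrow> y \<bullet> axis_vec i = 0)"
proof
  assume y: "y \<in> coord_subspace n"
  show "\<forall>i. n < i \<longrightarrow> i < DIM('a) \<longrightarrow> y \<bullet> axis_vec i = 0"
  proof (intro allI impI)
    fix i assume i: "n < i" "i < DIM('a)"
    have "orthogonal (axis_vec i) y"
      using y unfolding coord_subspace_def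
      by (rule orthogonal_to_span) (use i in \<open>auto simp: orthogonal_def inner_axis_vec\<close>)
    then show "y \<bullet> axis_vec i = 0"
      by (simp add: orthogonal_def inner_commute)
  qed
next
  assume r: "\<forall>i. n < i \<longrightarrow> i < DIM('a) \<longrightarrow> y \<bullet> axis_vec i = 0"
  have "(\<Sum>i<DIM('a). (y \<bullet> axis_vec i) *\<^sub>R (axis_vec i :: 'a)) \<in> coord_subspace n"
  proof (rule subspace_sum[OF subspace_coord_subspace])
    fix i assume "i \<in> {..<DIM('a)}"
    with r show "(y \<bullet> axis_vec i) *\<^sub>R (axis_vec i :: 'a) \<in> coord_subspace n"
      by (cases "n < i") (simp_all add: subspace_mul subspace_0 subspace_coord_subspace axis_vec_in_coord_subspace)
  qed
  then show "y \<in> coord_subspace n"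
    by (simp add: sum_axis_vec)
qed

lemma dim_coord_subspace:
  assumes "n < DIM('a)"
  shows "dim (coord_subspace n :: 'a::euclidean_space set) = Suc n"
proof -
  have sub: "axis_vec ` {..n} \<subseteq> (Basis :: 'a set)"
    using assms by (auto intro: axis_vec_in_Basis)
  have "inj_on (axis_vec :: nat \<Rightarrow> 'a) {..n}"
    using bij_betw_axis_vec[where 'a='a] assms by (auto simp: bij_betw_def intro: inj_on_subset)
  moreover have "independent (axis_vec ` {..n} :: 'a set)"
    using independent_mono[OF independent_Basis sub] .
  ultimately show ?thesis
    by (simp add: coord_subspace_def dim_eq_card_independent card_image)
qed

lemma coord_subspace_mono: "m \<le> n \<Longrightarrow> coord_subspace m \<subseteq> coord_subspace n"
  unfolding coord_subspace_def by (intro span_mono image_mono) auto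

lemma coord_subspace_Suc:
  fixes y :: "'a::euclidean_space"
  assumes "Suc n < DIM('a)"
  shows "y \<in> coord_subspace n \<longleftrightarrow> y \<in> coord_subspace (Suc n) \<and> y \<bullet> axis_vec (Suc n) = 0"
  using assms by (auto simp: mem_coord_subspace_iff) (metis Suc_lessI)

lemma uminus_in_coord_sphere: "x \<in> coord_sphere n \<Longrightarrow> - x \<in> coord_sphere n"
  by (simp add: coord_sphere_def subspace_neg subspace_coord_subspace)

lemma sgn_in_coord_sphere: "x \<in> coord_subspace n \<Longrightarrow> x \<noteq> 0 \<Longrightarrow> sgn x \<in> coord_sphere n"
  by (simp add: coord_sphere_def norm_sgn sgn_div_norm subspace_mul subspace_coord_subspace)

lemma coord_sphere_mono: "m \<le> n \<Longrightarrow> coord_sphere m \<subseteq> coord_sphere n"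
  using coord_subspace_mono unfolding coord_sphere_def by blast

section \<open>Degree of self-maps of coordinate spheres\<close>

text \<open>
  The type and the sequences are matched through coordinates, padded by zeros. Both
  directions are linear, so they commute with the antipodal map; this is why an arbitrary
  homeomorphism between the spheres would not do.
\<close>

definition from_coords :: "(nat \<Rightarrow> real) \<Rightarrow> 'a::euclidean_space" where
  "from_coords x = (\<Sum>i<DIM('a). x i *\<^sub>R axis_vec i)"

definition to_coords :: "'a::euclidean_space \<Rightarrow> nat \<Rightarrow> real" where
  "to_coords y = (\<lambda>i. if i < DIM('a) then y \<bullet> axis_vec i else 0)"

lemma from_to_coords [simp]: "from_coords (to_coords y) = (y :: 'a::euclidean_space)"
proof -
  have "(from_coords (to_coords y) :: 'a) = (\<Sum>i<DIM('a). (y \<bullet> axis_vec i) *\<^sub>R axis_vec i)"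
    unfolding from_coords_def to_coords_def by (rule sum.cong) auto
  then show ?thesis by (simp add: sum_axis_vec)
qed

lemma inner_from_coords:
  assumes "i < DIM('a)"
  shows "(from_coords x :: 'a::euclidean_space) \<bullet> axis_vec i = x i"
proof -
  have "(from_coords x :: 'a) \<bullet> axis_vec i = (\<Sum>j<DIM('a). if j = i then x j else 0)"
    unfolding from_coords_def inner_sum_left
    by (rule sum.cong) (use assms in \<open>auto simp: inner_axis_vec\<close>)
  then show ?thesis using assms by simp
qed

lemma norm_from_coords:
  "(norm (from_coords x :: 'a::euclidean_space))\<^sup>2 = (\<Sum>i<DIM('a). (x i)\<^sup>2)"
proof -
  have "(norm (from_coords x :: 'a))\<^sup>2 = (from_coords x :: 'a) \<bullet> (\<Sum>i<DIM('a). x i *\<^sub>R axis_vec i)"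
    by (simp add: dot_square_norm from_coords_def[symmetric])
  also have "\<dots> = (\<Sum>i<DIM('a). x i * x i)"
    by (simp add: inner_sum_right inner_from_coords)
  finally show ?thesis by (simp add: power2_eq_square)
qed

lemma from_coords_uminus: "from_coords (\<lambda>i. - x i) = - from_coords x"
  by (simp add: from_coords_def sum_negf)

lemma to_coords_uminus: "to_coords (- y) = (\<lambda>i. - to_coords y i)"
  by (auto simp: to_coords_def)

lemma sum_squares_nsphere:
  assumes "n < (N::nat)" "\<forall>i>n. x i = (0::real)"
  shows "(\<Sum>i<N. (x i)\<^sup>2) = (\<Sum>i\<le>n. (x i)\<^sup>2)"
proof (rule sum.mono_neutral_right)
  show "\<forall>i\<in>{..<N} - {..n}. (x i)\<^sup>2 = 0"
  proof
    fix i assume "i \<in> {..<N} - {..n}"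
    then have "n < i" by auto
    with assms(2) show "(x i)\<^sup>2 = 0" by simp
  qed
qed (use assms(1) in auto)

lemma from_coords_nsphere:
  assumes "n < DIM('a)" "x \<in> topspace (nsphere n)"
  shows "(from_coords x :: 'a::euclidean_space) \<in> coord_sphere n"
proof -
  have "(norm (from_coords x :: 'a))\<^sup>2 = 1"
    using assms by (simp add: norm_from_coords nsphere sum_squares_nsphere)
  then have "norm (from_coords x :: 'a) = 1"
    by (simp add: power2_eq_1_iff) (smt (verit) norm_ge_zero)
  then show ?thesis
    using assms by (auto simp: coord_sphere_def mem_coord_subspace_iff inner_from_coords nsphere)
qed

lemma to_coords_in_nsphere:
  fixes y :: "'a::euclidean_space"
  assumes "n < DIM('a)" "y \<in> coord_sphere n"
  shows "to_coords y \<in> topspace (nsphere n)"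
proof -
  have z: "\<forall>i>n. to_coords y i = 0"
    using assms by (auto simp: coord_sphere_def mem_coord_subspace_iff to_coords_def)
  have "(\<Sum>i\<le>n. (to_coords y i)\<^sup>2) = (norm (from_coords (to_coords y) :: 'a))\<^sup>2"
    unfolding norm_from_coords using assms(1) z by (simp add: sum_squares_nsphere)
  also have "\<dots> = 1"
    using assms by (simp add: coord_sphere_def)
  finally show ?thesis
    using z by (simp add: nsphere)
qed

lemma to_from_coords:
  assumes "n < DIM('a)" "x \<in> topspace (nsphere n)"
  shows "to_coords (from_coords x :: 'a::euclidean_space) = x"
  using assms by (auto simp: to_coords_def inner_from_coords nsphere)

lemma continuous_map_from_coords:
  assumes "n < DIM('a)"
  shows "continuous_map (nsphere n) (top_of_set (coord_sphere n :: 'a::euclidean_space set)) from_coords"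
proof -
  have "continuous_map (nsphere n) euclidean (\<lambda>x. x i *\<^sub>R (axis_vec i :: 'a))" for i
    using continuous_map_compose[OF continuous_map_nsphere_projection, of euclidean "\<lambda>t. t *\<^sub>R axis_vec i"]
    by (simp add: o_def continuous_intros)
  then have "continuous_map (nsphere n) euclidean (from_coords :: _ \<Rightarrow> 'a)"
    unfolding from_coords_def by (intro continuous_map_sum) auto
  then show ?thesis
    using assms by (auto simp: continuous_map_in_subtopology from_coords_nsphere)
qed

lemma continuous_map_to_coords:
  assumes "n < DIM('a)"
  shows "continuous_map (top_of_set (coord_sphere n :: 'a::euclidean_space set)) (nsphere n) to_coords"
proof -
  have "continuous_map (top_of_set (coord_sphere n)) (powertop_real UNIV) (to_coords :: 'a \<Rightarrow> _)"
    unfolding continuous_map_componentwise_UNIV to_coords_def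
    by (auto intro!: continuous_intros)
  moreover have "to_coords \<in> (coord_sphere n :: 'a set) \<rightarrow> topspace (nsphere n)"
    using assms to_coords_in_nsphere by auto
  ultimately show ?thesis
    by (auto simp: nsphere continuous_map_in_subtopology)
qed

definition sphere_degree :: "nat \<Rightarrow> ('a::euclidean_space \<Rightarrow> 'a) \<Rightarrow> int" where
  "sphere_degree n f = Brouwer_degree2 n (to_coords \<circ> f \<circ> from_coords)"

lemma continuous_map_coords:
  fixes f :: "'a::euclidean_space \<Rightarrow> 'a"
  assumes "n < DIM('a)" "continuous_on (coord_sphere n) f" "f \<in> coord_sphere n \<rightarrow> coord_sphere n"
  shows "continuous_map (nsphere n) (nsphere n) (to_coords \<circ> f \<circ> from_coords)"
proof -
  have "continuous_map (top_of_set (coord_sphere n)) (top_of_set (coord_sphere n)) f"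
    using assms by auto
  then show ?thesis
    using continuous_map_compose[OF continuous_map_compose[OF continuous_map_from_coords[OF assms(1)]]
        continuous_map_to_coords[OF assms(1)]] by (simp add: comp_assoc)
qed

lemma sphere_degree_cong:
  fixes f g :: "'a::euclidean_space \<Rightarrow> 'a"
  assumes "n < DIM('a)" "\<And>x. x \<in> coord_sphere n \<Longrightarrow> f x = g x"
  shows "sphere_degree n f = sphere_degree n g"
  unfolding sphere_degree_def using assms
  by (intro Brouwer_degree2_eq) (simp add: from_coords_nsphere)

lemma sphere_degree_homotopic:
  fixes f g :: "'a::euclidean_space \<Rightarrow> 'a"
  assumes "n < DIM('a)"
    and "homotopic_with_canon (\<lambda>x. True) (coord_sphere n) (coord_sphere n) f g"
  shows "sphere_degree n f = sphere_degree n g"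
  unfolding sphere_degree_def
  by (rule Brouwer_degree2_homotopic,
      rule homotopic_with_compose_continuous_map_right[OF
        homotopic_with_compose_continuous_map_left[OF assms(2) continuous_map_to_coords[OF assms(1)]]
        continuous_map_from_coords[OF assms(1)]]) auto

lemma sphere_degree_id:
  assumes "n < DIM('a)"
  shows "sphere_degree n (id :: 'a::euclidean_space \<Rightarrow> 'a) = 1"
proof -
  have "sphere_degree n (id :: 'a \<Rightarrow> 'a) = Brouwer_degree2 n id"
    unfolding sphere_degree_def using assms
    by (intro Brouwer_degree2_eq) (simp add: to_from_coords)
  then show ?thesis by simp
qed

lemma sphere_degree_const: "sphere_degree n (\<lambda>x. a) = 0"
  by (simp add: sphere_degree_def o_def Brouwer_degree2_const)

lemma sphere_degree_compose:
  fixes f g :: "'a::euclidean_space \<Rightarrow> 'a"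
  assumes n: "n < DIM('a)"
    and f: "continuous_on (coord_sphere n) f" "f \<in> coord_sphere n \<rightarrow> coord_sphere n"
    and g: "continuous_on (coord_sphere n) g" "g \<in> coord_sphere n \<rightarrow> coord_sphere n"
  shows "sphere_degree n (g \<circ> f) = sphere_degree n g * sphere_degree n f"
proof -
  have "sphere_degree n (g \<circ> f)
      = Brouwer_degree2 n ((to_coords \<circ> g \<circ> from_coords) \<circ> (to_coords \<circ> f \<circ> from_coords))"
    unfolding sphere_degree_def by (simp add: o_def)
  also have "\<dots> = sphere_degree n g * sphere_degree n f"
    unfolding sphere_degree_def
    by (intro Brouwer_degree2_compose continuous_map_coords assms)
  finally show ?thesis .
qed

text \<open>
  The homological input to the whole argument: Borsuk's parity step. It carries over from
  sequences because coordinates commute with negation and match the equators.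
\<close>

lemma sphere_degree_equator_parity:
  fixes f :: "'a::euclidean_space \<Rightarrow> 'a"
  assumes n: "Suc n < DIM('a)"
    and f: "continuous_on (coord_sphere (Suc n)) f"
      "f \<in> coord_sphere (Suc n) \<rightarrow> coord_sphere (Suc n)"
      "f \<in> coord_sphere n \<rightarrow> coord_sphere n"
    and odd: "\<And>x. x \<in> coord_sphere (Suc n) \<Longrightarrow> f (- x) = - f x"
  shows "even (sphere_degree (Suc n) f - sphere_degree n f)"
proof -
  have n': "n < DIM('a)" using n by simp
  let ?F = "to_coords \<circ> f \<circ> from_coords"
  have "even (Brouwer_degree2 (Suc n) ?F - Brouwer_degree2 (Suc n - Suc 0) ?F)"
  proof (rule Borsuk_odd_mapping_degree_step)
    show "continuous_map (nsphere (Suc n)) (nsphere (Suc n)) ?F"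
      by (intro continuous_map_coords assms)
    show "(?F \<circ> (\<lambda>x i. - x i)) u = ((\<lambda>x i. - x i) \<circ> ?F) u"
      if "u \<in> topspace (nsphere (Suc n))" for u
      using from_coords_nsphere[OF n that] by (simp add: from_coords_uminus to_coords_uminus odd)
    show "?F \<in> topspace (nsphere (Suc n - Suc 0)) \<rightarrow> topspace (nsphere (Suc n - Suc 0))"
      using from_coords_nsphere[OF n'] f(3) to_coords_in_nsphere[OF n'] by (auto simp: Pi_iff)
  qed
  then show ?thesis by (simp add: sphere_degree_def)
qed

section \<open>Deformation, approximation and reflection\<close>

text \<open>
  Radial projection by \<open>sgn\<close> turns a homotopy in the punctured subspace into a homotopy in
  the sphere. The linear homotopy suffices for both deformations of the degree argument.
\<close>

lemma sphere_degree_sgn_homotopic: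
  fixes f g :: "'a::euclidean_space \<Rightarrow> 'a"
  assumes n: "n < DIM('a)"
    and f: "continuous_on (coord_sphere n) f" "f \<in> coord_sphere n \<rightarrow> coord_subspace n"
    and g: "continuous_on (coord_sphere n) g" "g \<in> coord_sphere n \<rightarrow> coord_subspace n"
    and seg: "\<And>x. x \<in> coord_sphere n \<Longrightarrow> 0 \<notin> closed_segment (f x) (g x)"
  shows "sphere_degree n (sgn \<circ> f) = sphere_degree n (sgn \<circ> g)"
proof (rule sphere_degree_homotopic[OF n])
  have "homotopic_with_canon (\<lambda>x. True) (coord_sphere n) (coord_subspace n - {0}) f g"
  proof (rule homotopic_with_linear[OF f(1) g(1)])
    fix x :: 'a assume x: "x \<in> coord_sphere n"
    have "closed_segment (f x) (g x) \<subseteq> coord_subspace n"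
      using f(2) g(2) x
      by (intro closed_segment_subset subspace_imp_convex subspace_coord_subspace) auto
    with seg[OF x] show "closed_segment (f x) (g x) \<subseteq> coord_subspace n - {0}" by blast
  qed
  then show "homotopic_with_canon (\<lambda>x. True) (coord_sphere n) (coord_sphere n) (sgn \<circ> f) (sgn \<circ> g)"
    by (rule homotopic_with_compose_continuous_left)
       (auto intro!: continuous_intros sgn_in_coord_sphere)
qed

text \<open>
  Taking the odd part of an approximating polynomial does not increase the error, since the
  function is odd itself.
\<close>

lemma odd_polynomial_approximation:
  fixes f :: "'a::euclidean_space \<Rightarrow> 'a"
  assumes "compact S" "continuous_on S f" "0 < e" "subspace T" "f \<in> S \<rightarrow> T"
    and sym: "\<And>x. x \<in> S \<Longrightarrow> - x \<in> S"
    and odd: "\<And>x. x \<in> S \<Longrightarrow> f (- x) = - f x"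
  obtains p where "polynomial_function p" "p \<in> S \<rightarrow> T" "\<And>x. p (- x) = - p x"
    "\<And>x. x \<in> S \<Longrightarrow> norm (f x - p x) < e"
proof -
  obtain q where q: "polynomial_function q" "q ` S \<subseteq> T"
      and approx: "\<And>x. x \<in> S \<Longrightarrow> norm (f x - q x) < e"
    using Stone_Weierstrass_polynomial_function_subspace[of S f e T] assms by blast
  define p where "p x = (1/2) *\<^sub>R (q x - q (- x))" for x
  have "polynomial_function (\<lambda>x. q (- x))"
    using polynomial_function_compose[OF polynomial_function_minus[OF polynomial_function_id] q(1)]
    by (simp add: o_def)
  then have "polynomial_function p"
    unfolding p_def using q(1) by (intro polynomial_function_cmul polynomial_function_diff)
  moreover have "p \<in> S \<rightarrow> T"
    using q(2) sym by (auto simp: p_def image_subset_iff intro!: subspace_mul subspace_diff \<open>subspace T\<close>)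
  moreover have "p (- x) = - p x" for x
    by (simp add: p_def algebra_simps)
  moreover have "norm (f x - p x) < e" if x: "x \<in> S" for x
  proof -
    have "f x - p x = (1/2) *\<^sub>R ((f x - q x) - (f (- x) - q (- x)))"
      by (simp add: p_def odd[OF x] algebra_simps flip: scaleR_add_left)
    then have "norm (f x - p x) \<le> (1/2) * (norm (f x - q x) + norm (f (- x) - q (- x)))"
      by (simp add: norm_triangle_ineq4)
    also have "\<dots> < e"
      using approx[OF x] approx[OF sym[OF x]] by simp
    finally show ?thesis .
  qed
  ultimately show ?thesis by (rule that)
qed

text \<open>
  The reflection in the hyperplane orthogonal to \<open>w\<close>; for \<open>w = 0\<close> the division by zero makes
  it the identity, which is the right value when the two vectors to be exchanged coincide.
\<close>

definition reflection :: "'a::real_inner \<Rightarrow> 'a \<Rightarrow> 'a" where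
  "reflection w x = x - (2 * (x \<bullet> w) / (w \<bullet> w)) *\<^sub>R w"

lemma linear_reflection: "linear (reflection w)"
  by (rule linearI) (simp_all add: reflection_def algebra_simps inner_add_left add_divide_distrib)

lemma norm_reflection: "norm (reflection w x) = norm x"
proof -
  have "reflection w x \<bullet> reflection w x = x \<bullet> x"
    by (cases "w = 0")
       (simp_all add: reflection_def inner_diff_left inner_diff_right inner_commute field_simps power2_eq_square)
  then show ?thesis by (simp add: norm_eq)
qed

lemma reflection_swaps_unit_vectors:
  assumes "norm u = 1" "norm v = 1"
  shows "reflection (u - v) u = v"
proof (cases "u = v")
  case False
  have 1: "u \<bullet> u = 1" "v \<bullet> v = 1"
    using assms by (simp_all add: norm_eq_1)
  have "(u - v) \<bullet> (u - v) = 2 * (u \<bullet> (u - v))"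
    using 1 by (simp add: inner_diff_left inner_diff_right inner_commute)
  moreover have "(u - v) \<bullet> (u - v) \<noteq> 0"
    using False by (simp only: inner_eq_zero_iff right_minus_eq) simp
  ultimately have "2 * (u \<bullet> (u - v)) / ((u - v) \<bullet> (u - v)) = 1"
    by (metis divide_self)
  then show ?thesis unfolding reflection_def by (simp only: scaleR_one) simp
qed (simp add: reflection_def)

lemma reflection_in_subspace: "subspace S \<Longrightarrow> w \<in> S \<Longrightarrow> x \<in> S \<Longrightarrow> reflection w x \<in> S"
  by (simp add: reflection_def subspace_diff subspace_mul)

lemma sgn_linear_isometry:
  assumes "linear R" "\<And>x. norm (R x) = norm x"
  shows "sgn (R x) = R (sgn x)"
  using assms by (simp add: sgn_div_norm linear_scale)

lemma sgn_minus_vec: "sgn (- x) = - sgn (x :: 'a::real_normed_vector)"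
  by (simp add: sgn_div_norm)

section \<open>Odd maps have odd degree\<close>

text \<open>
  The zero-dimensional sphere has two points, so an odd self-map is the identity or the
  antipodal map. The latter is an involution, hence its degree squares to one.
\<close>

lemma odd_sphere_degree_of_dimension_zero:
  fixes f :: "'a::euclidean_space \<Rightarrow> 'a"
  assumes f: "f \<in> coord_sphere 0 \<rightarrow> coord_sphere 0"
    and odd: "\<And>x. x \<in> coord_sphere 0 \<Longrightarrow> f (- x) = - f x"
  shows "odd (sphere_degree 0 f)"
proof -
  have S: "(coord_sphere 0 :: 'a set) = {axis_vec 0, - axis_vec 0}"
  proof -
    have "norm (k *\<^sub>R (axis_vec 0 :: 'a)) = \<bar>k\<bar>" for k
      by (simp add: norm_axis_vec)
    then show ?thesis
      by (auto simp: coord_sphere_def coord_subspace_def span_singleton abs_eq_iff' norm_axis_vec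
           intro: range_eqI[of _ _ 1] range_eqI[of _ _ "-1"])
  qed
  have "f (axis_vec 0) \<in> {axis_vec 0, - axis_vec 0}"
    using f S by auto
  then consider "f (axis_vec 0) = axis_vec 0" | "f (axis_vec 0) = - axis_vec 0" by blast
  then show ?thesis
  proof cases
    case 1
    then have eq: "f x = id x" if "x \<in> coord_sphere 0" for x
      using odd[of "axis_vec 0"] that by (auto simp: S)
    have "sphere_degree 0 f = sphere_degree 0 (id :: 'a \<Rightarrow> 'a)"
      by (rule sphere_degree_cong[OF DIM_positive eq])
    then show ?thesis by (simp add: sphere_degree_id)
  next
    case 2
    then have eq: "f x = uminus x" if "x \<in> coord_sphere 0" for x
      using odd[of "axis_vec 0"] that by (auto simp: S)
    have "sphere_degree 0 f = sphere_degree 0 (uminus :: 'a \<Rightarrow> 'a)"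
      by (rule sphere_degree_cong[OF DIM_positive eq])
    moreover have "sphere_degree 0 (uminus \<circ> uminus :: 'a \<Rightarrow> 'a)
        = sphere_degree 0 (uminus :: 'a \<Rightarrow> 'a) * sphere_degree 0 (uminus :: 'a \<Rightarrow> 'a)"
      by (rule sphere_degree_compose)
         (simp_all add: continuous_on_minus[OF continuous_on_id] uminus_in_coord_sphere)
    moreover have "sphere_degree 0 (uminus \<circ> uminus :: 'a \<Rightarrow> 'a) = 1"
      using sphere_degree_id[where 'a = 'a, of 0] by (simp add: o_def id_def)
    ultimately have "sphere_degree 0 f * sphere_degree 0 f = 1" by simp
    then have "odd (sphere_degree 0 f * sphere_degree 0 f)" by simp
    then show ?thesis by simp
  qed
qed

text \<open>
  A differentiable image of a sphere cannot fill a sphere of higher dimension. Oddness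
  upgrades a missed point to a missed line: if the image contained the antipode of the
  missed point, it would contain the point too.
\<close>

lemma sgn_differentiable_image_misses_direction:
  fixes p :: "'a::euclidean_space \<Rightarrow> 'a"
  assumes n: "Suc n < DIM('a)"
    and p: "p differentiable_on coord_sphere n" "p \<in> coord_sphere n \<rightarrow> coord_subspace (Suc n)"
    and odd: "\<And>x. x \<in> coord_sphere n \<Longrightarrow> p (- x) = - p x"
    and nz: "\<And>x. x \<in> coord_sphere n \<Longrightarrow> p x \<noteq> 0"
  obtains v where "v \<in> coord_sphere (Suc n)" "\<And>x. x \<in> coord_sphere n \<Longrightarrow> p x \<notin> span {v}"
proof -
  have "(\<lambda>x. p x /\<^sub>R norm (p x)) differentiable_on coord_sphere n"
    using p(1) nz
    by (intro derivative_intros differentiable_on_compose[of p _ norm]) auto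
  then have "(\<lambda>x. sgn (p x)) differentiable_on sphere 0 1 \<inter> coord_subspace n"
    by (simp add: sgn_div_norm coord_sphere_def)
  then have "(\<lambda>x. sgn (p x)) ` (sphere 0 1 \<inter> coord_subspace n) \<noteq> sphere 0 1 \<inter> coord_subspace (Suc n)"
    using n by (intro spheremap_lemma1 subspace_coord_subspace coord_subspace_mono)
      (auto simp: dim_coord_subspace)
  moreover have "(\<lambda>x. sgn (p x)) ` coord_sphere n \<subseteq> coord_sphere (Suc n)"
    using p(2) nz by (auto intro!: sgn_in_coord_sphere)
  ultimately obtain v where v: "v \<in> coord_sphere (Suc n)" "v \<notin> (\<lambda>x. sgn (p x)) ` coord_sphere n"
    unfolding coord_sphere_def by blast
  have "p x \<notin> span {v}" if x: "x \<in> coord_sphere n" for x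
  proof
    assume "p x \<in> span {v}"
    then obtain c where c: "p x = c *\<^sub>R v" by (auto simp: span_singleton)
    have "norm v = 1" using v(1) by (simp add: coord_sphere_def)
    then have sv: "sgn v = v" by (simp add: sgn_div_norm)
    consider "c > 0" | "c < 0" | "c = 0" by linarith
    then show False
    proof cases
      case 1
      then have "sgn (p x) = v" using c sv by (simp add: sgn_scaleR)
      then show False using v(2) x by blast
    next
      case 2
      then have "sgn (p (- x)) = v" using c sv odd[OF x] by (simp add: sgn_scaleR sgn_minus_vec)
      then show False using v(2) uminus_in_coord_sphere[OF x] by blast
    next
      case 3
      then show False using c nz[OF x] by simp
    qed
  qed
  with v(1) show ?thesis by (rule that)
qed

text \<open>
  Borsuk's theorem on odd maps, by induction on the dimension. The parity step applies only
  to maps that preserve the equator, so the map must first be homotoped to an odd map of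
  this kind. An odd polynomial map \<open>p\<close> close to \<open>f\<close> misses some line on the equator; a
  reflection carries this line to the polar axis, giving a map \<open>q\<close> which is never polar on
  the equator. Damping the polar component of \<open>q x\<close> by the factor \<open>\<bar>x \<bullet> e\<bar>\<close>, which is even
  in \<open>x\<close> and vanishes exactly on the equator, keeps the map odd and pushes the image of the
  equator into the equator. The degree of the reflection is irrelevant: a factor of an odd
  product is odd.
\<close>

theorem odd_map_imp_odd_sphere_degree:
  fixes f :: "'a::euclidean_space \<Rightarrow> 'a"
  assumes "n < DIM('a)"
    and "continuous_on (coord_sphere n) f" "f \<in> coord_sphere n \<rightarrow> coord_sphere n"
    and "\<And>x. x \<in> coord_sphere n \<Longrightarrow> f (- x) = - f x"
  shows "odd (sphere_degree n f)"
  using assms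
proof (induction n arbitrary: f)
  case 0
  then show ?case by (intro odd_sphere_degree_of_dimension_zero)
next
  case (Suc n f)
  let ?S = "coord_sphere (Suc n) :: 'a set" and ?T = "coord_subspace (Suc n) :: 'a set"
  define e :: 'a where "e = axis_vec (Suc n)"
  note N = \<open>Suc n < DIM('a)\<close>
  have e: "norm e = 1" "e \<in> ?T"
    using N by (simp_all add: e_def norm_axis_vec axis_vec_in_coord_subspace)
  have eq: "x \<in> coord_sphere n \<longleftrightarrow> x \<in> ?S \<and> x \<bullet> e = 0" for x
    using coord_subspace_Suc[OF N, of x] by (auto simp: coord_sphere_def e_def)
  obtain p where p: "polynomial_function p" "p \<in> ?S \<rightarrow> ?T" "\<And>x. p (- x) = - p x"
    and approx: "\<And>x. x \<in> ?S \<Longrightarrow> norm (f x - p x) < 1"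
  proof (rule odd_polynomial_approximation[of ?S f 1 ?T])
    show "compact ?S"
      by (simp add: coord_sphere_def compact_Int_closed closed_subspace subspace_coord_subspace)
    show "f \<in> ?S \<rightarrow> ?T"
      using Suc.prems(3) by (auto simp: coord_sphere_def)
  qed (use Suc.prems in \<open>auto simp: uminus_in_coord_sphere subspace_coord_subspace\<close>)
  have contp: "continuous_on A p" for A
    using continuous_on_polymonial_function[OF p(1)] .
  have seg: "0 \<notin> closed_segment (f x) (p x)" if x: "x \<in> ?S" for x
  proof
    assume "0 \<in> closed_segment (f x) (p x)"
    then have "norm (0 - f x) \<le> norm (p x - f x)"
      by (rule segment_bound1)
    moreover have "norm (f x) = 1" using Suc.prems(3) x by (auto simp: coord_sphere_def)
    ultimately show False using approx[OF x] by (simp add: norm_minus_commute)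
  qed
  have pnz: "p x \<noteq> 0" if "x \<in> ?S" for x
    using seg[OF that] by auto
  have degp: "sphere_degree (Suc n) f = sphere_degree (Suc n) (sgn \<circ> p)"
  proof -
    have "sphere_degree (Suc n) f = sphere_degree (Suc n) (sgn \<circ> f)"
    proof (rule sphere_degree_cong[OF N])
      fix x :: 'a assume "x \<in> ?S"
      then have "norm (f x) = 1" using Suc.prems(3) by (auto simp: coord_sphere_def)
      then show "f x = (sgn \<circ> f) x" by (simp add: sgn_div_norm)
    qed
    also have "\<dots> = sphere_degree (Suc n) (sgn \<circ> p)"
      by (rule sphere_degree_sgn_homotopic[OF N])
         (use Suc.prems(2,3) p(2) contp seg in \<open>auto simp: coord_sphere_def\<close>)
    finally show ?thesis .
  qed
  obtain v where v: "v \<in> ?S" and miss: "\<And>x. x \<in> coord_sphere n \<Longrightarrow> p x \<notin> span {v}"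
  proof (rule sgn_differentiable_image_misses_direction[OF N, of p])
    show "p differentiable_on coord_sphere n"
      by (rule differentiable_on_polynomial_function[OF p(1)])
  qed (use p(2,3) pnz eq in auto)
  define R where "R = reflection (v - e)"
  have R: "linear R" "\<And>x. norm (R x) = norm x" "R v = e" "\<And>x. x \<in> ?T \<Longrightarrow> R x \<in> ?T"
    using v e linear_reflection norm_reflection
    by (auto simp: R_def coord_sphere_def intro!: reflection_swaps_unit_vectors
        reflection_in_subspace subspace_diff subspace_coord_subspace)
  have contR: "continuous_on A R" for A
    using R(1) by (simp add: linear_continuous_on linear_conv_bounded_linear)
  define q where "q = R \<circ> p"
  have contq: "continuous_on A q" for A
    unfolding q_def by (rule continuous_on_compose[OF contp contR])
  have q: "q \<in> ?S \<rightarrow> ?T" "q (- x) = - q x" "\<And>x. x \<in> ?S \<Longrightarrow> q x \<noteq> 0" for x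
  proof -
    show "q \<in> ?S \<rightarrow> ?T" using p(2) R(4) by (auto simp: q_def Pi_iff)
    show "q (- x) = - q x" by (simp add: q_def p(3) linear_neg[OF R(1)])
    show "q x \<noteq> 0" if "x \<in> ?S" for x
      using pnz[OF that] R(2)[of "p x"] by (auto simp: q_def)
  qed
  have missq: "q x \<noteq> c *\<^sub>R e" if x: "x \<in> coord_sphere n" for x c
  proof
    assume "q x = c *\<^sub>R e"
    then have "R (p x - c *\<^sub>R v) = 0"
      by (simp add: q_def linear_diff[OF R(1)] linear_scale[OF R(1)] R(3))
    then have "p x = c *\<^sub>R v"
      using R(2)[of "p x - c *\<^sub>R v"] by simp
    then show False
      using miss[OF x] by (auto simp: span_singleton)
  qed
  define g where "g x = q x - ((1 - \<bar>x \<bullet> e\<bar>) * (q x \<bullet> e)) *\<^sub>R e" for x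
  have contg: "continuous_on A g" for A
    unfolding g_def by (intro continuous_intros contq)
  have gT: "g \<in> ?S \<rightarrow> ?T"
    using q(1) e(2) by (auto simp: g_def intro!: subspace_diff subspace_mul subspace_coord_subspace)
  have gseg: "0 \<notin> closed_segment (q x) (g x)" if x: "x \<in> ?S" for x
  proof
    assume "0 \<in> closed_segment (q x) (g x)"
    then obtain s where s: "0 \<le> s" "s \<le> 1" "0 = (1 - s) *\<^sub>R q x + s *\<^sub>R g x"
      by (auto simp: in_segment)
    \<comment> \<open>If the segment hits zero, then \<open>q x\<close> is polar and the fraction removed from it is one, so \<open>x\<close> is on the equator.\<close>
    define c where "c = s * (1 - \<bar>x \<bullet> e\<bar>) * (q x \<bullet> e)"
    have qc: "q x = c *\<^sub>R e"
      using s(3) by (simp add: g_def c_def algebra_simps)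
    have "q x \<bullet> e = c"
      using e(1) by (simp add: qc norm_eq_1)
    moreover have "c \<noteq> 0" using qc q(3)[OF x] by auto
    ultimately have "s * (1 - \<bar>x \<bullet> e\<bar>) = 1"
      unfolding c_def by auto
    moreover have "\<bar>x \<bullet> e\<bar> \<le> 1"
      using Cauchy_Schwarz_ineq2[of x e] e(1) x by (simp add: coord_sphere_def)
    ultimately have "x \<bullet> e = 0"
      using s(1,2) mult_left_le_one_le[of "1 - \<bar>x \<bullet> e\<bar>" s] by auto
    then show False
      using missq qc x eq by blast
  qed
  have gnz: "g x \<noteq> 0" if "x \<in> ?S" for x
    using gseg[OF that] by auto
  have "even (sphere_degree (Suc n) (sgn \<circ> g) - sphere_degree n (sgn \<circ> g))"
    and "odd (sphere_degree n (sgn \<circ> g))"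
  proof -
    have cont: "continuous_on ?S (sgn \<circ> g)"
      unfolding o_def using gnz by (intro continuous_on_sgn contg) auto
    have into: "sgn \<circ> g \<in> ?S \<rightarrow> ?S"
      using gT gnz by (auto intro!: sgn_in_coord_sphere)
    have oddg: "(sgn \<circ> g) (- x) = - (sgn \<circ> g) x" for x
    proof -
      have "g (- x) = - g x" by (simp add: g_def q(2))
      then show ?thesis by (simp add: sgn_minus_vec)
    qed
    have equator: "sgn \<circ> g \<in> coord_sphere n \<rightarrow> coord_sphere n"
    proof
      fix x :: 'a assume x: "x \<in> coord_sphere n"
      then have "x \<in> ?S" "x \<bullet> e = 0" by (simp_all add: eq)
      then have "g x \<bullet> e = 0"
        using e(1) by (simp add: g_def inner_diff_left norm_eq_1)
      then have "(sgn \<circ> g) x \<bullet> e = 0" by (simp add: sgn_div_norm)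
      then show "(sgn \<circ> g) x \<in> coord_sphere n"
        using into \<open>x \<in> ?S\<close> by (auto simp: eq)
    qed
    show "even (sphere_degree (Suc n) (sgn \<circ> g) - sphere_degree n (sgn \<circ> g))"
      by (rule sphere_degree_equator_parity[OF N cont into equator oddg])
    show "odd (sphere_degree n (sgn \<circ> g))"
      using N continuous_on_subset[OF cont] coord_sphere_mono[of n "Suc n"] equator oddg
      by (intro Suc.IH) auto
  qed
  then have "odd (sphere_degree (Suc n) (sgn \<circ> g))" by presburger
  also have "sphere_degree (Suc n) (sgn \<circ> g) = sphere_degree (Suc n) (sgn \<circ> q)"
    by (rule sphere_degree_sgn_homotopic[OF N, symmetric])
       (use contq contg q(1) gT gseg in auto)
  also have "sgn \<circ> q = R \<circ> (sgn \<circ> p)"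
    by (auto simp: q_def sgn_linear_isometry[OF R(1,2)])
  also have "sphere_degree (Suc n) (R \<circ> (sgn \<circ> p))
      = sphere_degree (Suc n) R * sphere_degree (Suc n) (sgn \<circ> p)"
  proof (rule sphere_degree_compose[OF N _ _ contR])
    show "continuous_on ?S (sgn \<circ> p)"
      unfolding o_def using pnz by (intro continuous_on_sgn contp) auto
    show "sgn \<circ> p \<in> ?S \<rightarrow> ?S"
      using p(2) pnz by (auto intro!: sgn_in_coord_sphere)
    show "R \<in> ?S \<rightarrow> ?S"
      using R(2,4) by (auto simp: coord_sphere_def)
  qed
  finally show ?case by (simp add: degp)
qed

section \<open>The Borsuk--Ulam theorem\<close>

text \<open>
  Restricted to the equator, such a map extends over a hemisphere, so it is nullhomotopic
  and its degree is zero. This contradicts the oddness of the degree.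
\<close>

lemma no_odd_map_to_equator:
  fixes h :: "'a::euclidean_space \<Rightarrow> 'a"
  assumes N: "Suc n < DIM('a)"
    and h: "continuous_on (coord_sphere (Suc n)) h" "h \<in> coord_sphere (Suc n) \<rightarrow> coord_sphere n"
    and odd: "\<And>x. x \<in> coord_sphere (Suc n) \<Longrightarrow> h (- x) = - h x"
  shows False
proof -
  have n: "n < DIM('a)" using N by simp
  define e :: 'a where "e = axis_vec (Suc n)"
  have e: "norm e = 1" "e \<in> coord_subspace (Suc n)"
    using N by (simp_all add: e_def norm_axis_vec axis_vec_in_coord_subspace)
  have sub: "coord_sphere n \<subseteq> (coord_sphere (Suc n) :: 'a set)"
    by (rule coord_sphere_mono) simp
  \<comment> \<open>The segment from a point of the equator to the pole, projected to the sphere, is a meridian of the upper hemisphere.\<close>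
  have "homotopic_with_canon (\<lambda>x. True) (coord_sphere n) (coord_subspace (Suc n) - {0}) id (\<lambda>x. e)"
  proof (rule homotopic_with_linear)
    fix x :: 'a assume x: "x \<in> coord_sphere n"
    then have x': "x \<in> coord_subspace (Suc n)" "x \<bullet> e = 0" "norm x = 1"
      using coord_subspace_Suc[OF N, of x] by (auto simp: coord_sphere_def e_def)
    have "closed_segment x e \<subseteq> coord_subspace (Suc n)"
      using x'(1) e(2) by (intro closed_segment_subset subspace_imp_convex subspace_coord_subspace) auto
    moreover have "0 \<notin> closed_segment x e"
    proof
      assume "0 \<in> closed_segment x e"
      then obtain s where s: "0 = (1 - s) *\<^sub>R x + s *\<^sub>R e" by (auto simp: in_segment)
      from arg_cong[OF s, of "\<lambda>y. y \<bullet> e"] have "s = 0"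
        using x'(2) e(1) by (auto simp: inner_add_left norm_eq_1)
      with s x'(3) show False by auto
    qed
    ultimately show "closed_segment (id x) e \<subseteq> coord_subspace (Suc n) - {0}" by auto
  qed auto
  then have "homotopic_with_canon (\<lambda>x. True) (coord_sphere n) (coord_sphere n)
      ((h \<circ> sgn) \<circ> id) ((h \<circ> sgn) \<circ> (\<lambda>x. e))"
  proof (rule homotopic_with_compose_continuous_left)
    have S: "sgn ` (coord_subspace (Suc n) - {0}) \<subseteq> (coord_sphere (Suc n) :: 'a set)"
      by (auto intro: sgn_in_coord_sphere)
    show "continuous_on (coord_subspace (Suc n) - {0}) (h \<circ> sgn)"
      by (rule continuous_on_compose[OF _ continuous_on_subset[OF h(1) S]])
         (auto intro!: continuous_intros)
    show "h \<circ> sgn \<in> coord_subspace (Suc n) - {0} \<rightarrow> coord_sphere n"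
      using h(2) S by (auto simp: Pi_iff image_subset_iff)
  qed
  from sphere_degree_homotopic[OF n this]
  have "sphere_degree n (h \<circ> sgn) = 0"
    by (simp add: o_def sphere_degree_const)
  moreover have "sphere_degree n (h \<circ> sgn) = sphere_degree n h"
    by (rule sphere_degree_cong[OF n]) (simp add: coord_sphere_def sgn_div_norm)
  moreover have "odd (sphere_degree n h)"
    using continuous_on_subset[OF h(1) sub] h(2) odd sub
    by (intro odd_map_imp_odd_sphere_degree[OF n]) auto
  ultimately show False by simp
qed

text \<open>
  The Borsuk--Ulam theorem for the unit sphere of a subspace. If \<open>g\<close> had no zero, then
  normalizing it and transporting source and target by linear isometries would give an odd
  map from a coordinate sphere to its equator.
\<close>

theorem Borsuk_Ulam_subspace:
  fixes g :: "'a::euclidean_space \<Rightarrow> 'b::euclidean_space"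
  assumes W: "subspace W" "DIM('b) < dim W"
    and g: "continuous_on (sphere 0 1 \<inter> W) g"
    and odd: "\<And>x. x \<in> sphere 0 1 \<inter> W \<Longrightarrow> g (- x) = - g x"
  shows "\<exists>x \<in> sphere 0 1 \<inter> W. g x = 0"
proof (rule ccontr)
  assume "\<not> ?thesis"
  then have nz: "\<And>x. x \<in> sphere 0 1 \<inter> W \<Longrightarrow> g x \<noteq> 0" by blast
  obtain k where k: "DIM('b) = Suc k"
    using DIM_positive[where 'a = 'b] gr0_implies_Suc by blast
  have N: "Suc k < DIM('a)"
    using W(2) dim_subset_UNIV[of W] k by simp
  obtain U :: "'a \<Rightarrow> 'a" where U: "linear U" "U \<in> coord_subspace (Suc k) \<rightarrow> W"
    "\<And>x. x \<in> coord_subspace (Suc k) \<Longrightarrow> norm (U x) = norm x"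
    using isometry_subset_subspace[OF subspace_coord_subspace[of "Suc k", where 'a = 'a] W(1)]
      W(2) k dim_coord_subspace[OF N] by (metis Suc_leI)
  obtain J :: "'b \<Rightarrow> 'a" where J: "linear J" "J \<in> UNIV \<rightarrow> coord_subspace k" "\<And>x. norm (J x) = norm x"
  proof (rule isometry_subset_subspace[OF subspace_UNIV subspace_coord_subspace])
    show "dim (UNIV :: 'b set) \<le> dim (coord_subspace k :: 'a set)"
      using k N by (simp add: dim_coord_subspace)
  qed auto
  have US: "U x \<in> sphere 0 1 \<inter> W" if "x \<in> coord_sphere (Suc k)" for x
    using that U(2,3) by (auto simp: coord_sphere_def)
  show False
  proof (rule no_odd_map_to_equator[OF N, of "\<lambda>x. J (sgn (g (U x)))"])
    have "continuous_on (coord_sphere (Suc k)) U"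
      using U(1) by (simp add: linear_continuous_on linear_conv_bounded_linear)
    then have "continuous_on (coord_sphere (Suc k)) (\<lambda>x. sgn (g (U x)))"
      by (intro continuous_on_sgn continuous_on_compose2[OF g]) (use US nz in auto)
    then show "continuous_on (coord_sphere (Suc k)) (\<lambda>x. J (sgn (g (U x))))"
      by (rule bounded_linear.continuous_on[OF J(1)[unfolded linear_conv_bounded_linear]])
    show "(\<lambda>x. J (sgn (g (U x)))) \<in> coord_sphere (Suc k) \<rightarrow> coord_sphere k"
      using J(2,3) nz US by (auto simp: coord_sphere_def[of k] norm_sgn)
    show "J (sgn (g (U (- x)))) = - J (sgn (g (U x)))" if "x \<in> coord_sphere (Suc k)" for x
      using odd[OF US[OF that]] by (simp add: linear_neg[OF U(1)] linear_neg[OF J(1)] sgn_minus_vec)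
  qed
qed

section \<open>Orthogonal points with equal values\<close>

theorem theorem4p1:
  fixes m d :: nat
    and f :: "real ^ 'n \<Rightarrow> real ^ 'd"
  assumes "CARD('n) = m + 1" and "CARD('d) = d"
    and "d \<ge> 1"
    and "continuous_on (sphere 0 1) f"
    and "m > d"
  shows "\<exists>p1 \<in> sphere 0 1. \<exists>p2 \<in> sphere 0 1. orthogonal p1 p2 \<and> f p1 = f p2"
proof -
  obtain u :: "real ^ 'n" where u: "norm u = 1"
    using vector_choose_size[of 1] by auto
  define W where "W = {v. u \<bullet> v = 0}"
  \<comment> \<open>For \<open>v\<close> in the unit sphere of \<open>W\<close>, rotating the orthonormal pair \<open>u, v\<close> by 45 degrees gives the orthonormal pair \<open>P (- v), P v\<close>.\<close>
  define P where "P v = (u + v) /\<^sub>R sqrt 2" for v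
  define g where "g v = f (P v) - f (P (- v))" for v
  have P: "P v \<in> sphere 0 1" "orthogonal (P v) (P (- v))" "- v \<in> sphere 0 1 \<inter> W"
    if "v \<in> sphere 0 1 \<inter> W" for v
  proof -
    have v: "u \<bullet> u = 1" "v \<bullet> v = 1" "u \<bullet> v = 0" "v \<bullet> u = 0"
      using u that by (auto simp: W_def norm_eq_1 inner_commute)
    show "P v \<in> sphere 0 1"
      using v unfolding mem_sphere_0 norm_eq_1
      by (simp add: P_def inner_add_left inner_add_right field_simps)
    show "orthogonal (P v) (P (- v))"
      using v by (simp add: P_def orthogonal_def inner_diff_right inner_add_left)
    show "- v \<in> sphere 0 1 \<inter> W"
      using that by (simp add: W_def)
  qed
  have "\<exists>v \<in> sphere 0 1 \<inter> W. g v = 0"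
  proof (rule Borsuk_Ulam_subspace)
    show "subspace W"
      unfolding W_def by (rule subspace_hyperplane)
    have "u \<noteq> 0" using u by auto
    then show "DIM(real ^ 'd) < dim W"
      using assms by (simp add: W_def dim_hyperplane)
    have "continuous_on (sphere 0 1 \<inter> W) P" "continuous_on (sphere 0 1 \<inter> W) (\<lambda>v. P (- v))"
      unfolding P_def by (intro continuous_intros)+
    then show "continuous_on (sphere 0 1 \<inter> W) g"
      unfolding g_def using P(1,3)
      by (intro continuous_on_diff continuous_on_compose2[OF assms(4)]) auto
  qed (simp add: g_def)
  then obtain v where "v \<in> sphere 0 1 \<inter> W" "g v = 0" by blast
  then show ?thesis
    using P by (intro bexI[of _ "P v"] bexI[of _ "P (- v)"]) (auto simp: g_def)
qed

end
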